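(* Let $n,m\ge 0$ be integers with $2n+m\ge 1$ and $(n,m)\neq(0,1)$. For every pair of integers $k\ge 2$ and $r\ge 2$ there exists an $(n,m)$-graph $G_k$ such that $\mathrm{arb}(\mathrm{und}(G_k))\le r$ and $\chi_{n,m}(G_k)\ge k$.
   Context: All graphs are finite. An $(n,m)$-graph $G$ is a graph with $n$ types of arcs (labeled $2,4,\ldots,2n$) and $m$ types of edges (labeled $2n+1,\ldots,2n+m$), whose underlying undirected graph $\mathrm{und}(G)$ is simple (so each adjacent pair of distinct vertices is joined by exactly one arc or exactly one edge, with exactly one type, and there are no loops). A homomorphism of an $(n,m)$-graph $G$ to an $(n,m)$-graph $H$ is a map $f:V(G)\to V(H)$ such that whenever $uv$ is an arc from $u$ to $v$ (resp. an edge) of type $\alpha$ in $G$, $f(u)f(v)$ is an arc from $f(u)$ to $f(v)$ (resp. an edge) of type $\alpha$ in $H$; write $G\to H$ if one exists. For an $(n,m)$-graph $G$, $\chi_{n,m}(G)=\min\{|V(H)|: H \text{ an } (n,m)\text{-graph},\ G\to H\}$. The arboricity $\mathrm{arb}(G)$ of a graph $G$ is the minimum $r$ such that the edge set of $G$ can be decomposed into $r$ forests. *)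

theory Defs
  imports Main "HOL-Library.Disjoint_Sets"
begin

section \<open>Simple graphs and arboricity\<close>

text \<open>An undirected graph is a pair of a vertex set and a set of edges, each edge being
  the set of its two end vertices.\<close>

type_synonym 'a ugraph = "'a set \<times> 'a set set"

definition simple_graph :: "'a ugraph \<Rightarrow> bool" where
  "simple_graph G \<longleftrightarrow> finite (fst G) \<and> (\<forall>e\<in>snd G. e \<subseteq> fst G \<and> card e = 2)"

definition is_cycle :: "'a set set \<Rightarrow> 'a list \<Rightarrow> bool" where
  "is_cycle E p \<longleftrightarrow> 3 \<le> length p \<and> distinct p \<and>
     (\<forall>i<length p. {p ! i, p ! (Suc i mod length p)} \<in> E)"

definition is_forest :: "'a set set \<Rightarrow> bool" where
  "is_forest E \<longleftrightarrow> (\<nexists>p. is_cycle E p)"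

text \<open>Some of the \<open>r\<close> forests may be empty; this does not affect the minimum.\<close>

definition forest_decomposition :: "'a set set \<Rightarrow> nat \<Rightarrow> (nat \<Rightarrow> 'a set set) \<Rightarrow> bool" where
  "forest_decomposition E r F \<longleftrightarrow>
     (\<Union>i<r. F i) = E \<and> disjoint_family_on F {..<r} \<and> (\<forall>i<r. is_forest (F i))"

definition arboricity :: "'a ugraph \<Rightarrow> nat" where
  "arboricity G = (LEAST r. \<exists>F. forest_decomposition (snd G) r F)"

section \<open>Graphs with typed arcs and typed edges\<close>

record 'a mixed_graph =
  verts :: "'a set"
  arcs :: "nat \<Rightarrow> ('a \<times> 'a) set"  \<comment> \<open>the arcs of each type, as (tail, head)\<close>
  edges :: "nat \<Rightarrow> 'a set set"  \<comment> \<open>the edges of each type\<close>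

definition und :: "'a mixed_graph \<Rightarrow> 'a ugraph" where
  "und G = (verts G,
     {{u, v} | u v. \<exists>\<alpha>. (u, v) \<in> arcs G \<alpha>} \<union> {e. \<exists>\<alpha>. e \<in> edges G \<alpha>})"

text \<open>The last four conjuncts say that two adjacent vertices are joined by only one arc or
  edge, which has only one type. Loops are excluded by simplicity of \<open>und G\<close>.\<close>

definition nm_graph :: "nat \<Rightarrow> nat \<Rightarrow> 'a mixed_graph \<Rightarrow> bool" where
  "nm_graph n m G \<longleftrightarrow>
     simple_graph (und G) \<and>
     (\<forall>\<alpha>. arcs G \<alpha> \<noteq> {} \<longrightarrow> \<alpha> \<in> {2 * i | i. 1 \<le> i \<and> i \<le> n}) \<and>
     (\<forall>\<alpha>. edges G \<alpha> \<noteq> {} \<longrightarrow> \<alpha> \<in> {2 * n + 1 .. 2 * n + m}) \<and>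
     (\<forall>u v \<alpha> \<beta>. (u, v) \<in> arcs G \<alpha> \<longrightarrow> (u, v) \<in> arcs G \<beta> \<longrightarrow> \<alpha> = \<beta>) \<and>
     (\<forall>u v \<alpha> \<beta>. (u, v) \<in> arcs G \<alpha> \<longrightarrow> (v, u) \<notin> arcs G \<beta>) \<and>
     (\<forall>u v \<alpha> \<beta>. (u, v) \<in> arcs G \<alpha> \<longrightarrow> {u, v} \<notin> edges G \<beta>) \<and>
     (\<forall>e \<alpha> \<beta>. e \<in> edges G \<alpha> \<longrightarrow> e \<in> edges G \<beta> \<longrightarrow> \<alpha> = \<beta>)"

definition nm_hom :: "('a \<Rightarrow> 'b) \<Rightarrow> 'a mixed_graph \<Rightarrow> 'b mixed_graph \<Rightarrow> bool" where
  "nm_hom f G H \<longleftrightarrow>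
     f ` verts G \<subseteq> verts H \<and>
     (\<forall>u v \<alpha>. (u, v) \<in> arcs G \<alpha> \<longrightarrow> (f u, f v) \<in> arcs H \<alpha>) \<and>
     (\<forall>u v \<alpha>. {u, v} \<in> edges G \<alpha> \<longrightarrow> {f u, f v} \<in> edges H \<alpha>)"

text \<open>The targets range over graphs with vertices in \<open>nat\<close>. As graphs are finite, this is no
  restriction: see \<open>nm_chromatic_le\<close> below, where the target has an arbitrary vertex type.\<close>

definition nm_chromatic :: "nat \<Rightarrow> nat \<Rightarrow> 'a mixed_graph \<Rightarrow> nat" where
  "nm_chromatic n m G =
     (LEAST c. \<exists>(H :: nat mixed_graph) f. nm_graph n m H \<and> nm_hom f G H \<and> card (verts H) = c)"

section \<open>The two minima are attained\<close>

lemma forest_decomposition_exists: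
  assumes "simple_graph G"
  shows "\<exists>r F. forest_decomposition (snd G) r F"
proof -
  have "snd G \<subseteq> Pow (fst G)" "finite (fst G)"
    using assms by (auto simp: simple_graph_def)
  then have "finite (snd G)" by (meson finite_Pow_iff finite_subset)
  then obtain h and r :: nat where h: "bij_betw h {..<r} (snd G)"
    by (metis ex_bij_betw_nat_finite atLeast0LessThan)
  have "is_forest {e}" for e :: "'a set"
    unfolding is_forest_def
  proof
    assume "\<exists>p. is_cycle {e} p"
    then obtain p where p: "is_cycle {e} p" ..
    then have l: "3 \<le> length p" and d: "distinct p"
      and i: "\<And>i. i < length p \<Longrightarrow> {p ! i, p ! (Suc i mod length p)} = e"
      by (auto simp: is_cycle_def)
    have "0 < length p" "1 < length p" "2 < length p" using l by auto
    note lens = this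
    have "Suc 0 mod length p = 1" "Suc 1 mod length p = 2" using l by auto
    then have "{p ! 0, p ! 1} = e" "{p ! 1, p ! 2} = e"
      using i[OF lens(1)] i[OF lens(2)] by simp_all
    then have "{p ! 0, p ! 1} = {p ! 1, p ! 2}" by simp
    then have "p ! 0 = p ! 1 \<or> p ! 0 = p ! 2" by (auto simp: doubleton_eq_iff)
    moreover have "p ! 0 \<noteq> p ! 1" using d lens by (simp add: nth_eq_iff_index_eq)
    moreover have "p ! 0 \<noteq> p ! 2" using d lens by (simp add: nth_eq_iff_index_eq)
    ultimately show False by blast
  qed
  moreover have "(\<Union>i<r. {h i}) = snd G"
    using h UNION_singleton_eq_range[of h "{..<r}"] by (simp add: bij_betw_def)
  moreover have "disjoint_family_on (\<lambda>i. {h i}) {..<r}"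
  proof (unfold disjoint_family_on_def, intro ballI impI)
    fix i j assume "i \<in> {..<r}" "j \<in> {..<r}" "i \<noteq> j"
    then have "h i \<noteq> h j" using h by (meson bij_betw_def inj_onD)
    then show "{h i} \<inter> {h j} = {}" by simp
  qed
  ultimately have "forest_decomposition (snd G) r (\<lambda>i. {h i})"
    by (simp only: forest_decomposition_def simp_thms)
  then show ?thesis by blast
qed

lemma arboricity_attained:
  assumes "simple_graph G"
  shows "\<exists>F. forest_decomposition (snd G) (arboricity G) F"
  using forest_decomposition_exists[OF assms] unfolding arboricity_def by (rule LeastI_ex)

lemma nm_relabel:
  fixes G :: "'a mixed_graph"
  assumes G: "nm_graph n m G"
  shows "\<exists>(H :: nat mixed_graph) f. nm_graph n m H \<and> nm_hom f G H \<and> card (verts H) = card (verts G)"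
proof -
  have "finite (verts G)" using G by (simp add: nm_graph_def simple_graph_def und_def)
  then obtain g :: "'a \<Rightarrow> nat" where g: "inj_on g (verts G)"
    using finite_imp_inj_to_nat_seg by metis
  define H :: "nat mixed_graph" where
    "H = \<lparr>verts = g ` verts G, arcs = (\<lambda>\<alpha>. map_prod g g ` arcs G \<alpha>), edges = (\<lambda>\<alpha>. (`) g ` edges G \<alpha>)\<rparr>"
  have sel: "verts H = g ` verts G" "arcs H \<alpha> = map_prod g g ` arcs G \<alpha>"
    "edges H \<alpha> = (`) g ` edges G \<alpha>" for \<alpha>
    by (simp_all add: H_def)
  have und_e: "snd (und H) = (`) g ` snd (und G)"
  proof (intro set_eqI iffI)
    fix e assume "e \<in> snd (und H)"
    then consider a b \<alpha> where "(a, b) \<in> arcs G \<alpha>" "e = g ` {a, b}"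
      | e' \<alpha> where "e' \<in> edges G \<alpha>" "e = g ` e'"
      by (auto simp: und_def sel)
    then show "e \<in> (`) g ` snd (und G)"
    proof cases
      case 1
      then have "{a, b} \<in> snd (und G)" by (auto simp: und_def)
      then show ?thesis using 1(2) by blast
    next
      case 2
      then have "e' \<in> snd (und G)" by (auto simp: und_def)
      then show ?thesis using 2(2) by blast
    qed
  next
    fix e assume "e \<in> (`) g ` snd (und G)"
    then consider a b \<alpha> where "(a, b) \<in> arcs G \<alpha>" "e = g ` {a, b}"
      | e' \<alpha> where "e' \<in> edges G \<alpha>" "e = g ` e'"
      by (auto simp: und_def)
    then show "e \<in> snd (und H)"
    proof cases
      case 1
      then have "(g a, g b) \<in> arcs H \<alpha>" by (force simp: sel)
      then have "{g a, g b} \<in> snd (und H)" by (auto simp: und_def)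
      then show ?thesis using 1(2) by simp
    next
      case 2
      then have "e \<in> edges H \<alpha>" by (simp add: sel)
      then show ?thesis by (auto simp: und_def)
    qed
  qed
  have s: "\<forall>e\<in>snd (und G). e \<subseteq> verts G \<and> card e = 2"
    using G by (auto simp: nm_graph_def simple_graph_def und_def)
  have aV: "u \<in> verts G \<and> v \<in> verts G" if "(u, v) \<in> arcs G \<alpha>" for u v \<alpha>
  proof -
    have "{u, v} \<in> snd (und G)" using that by (auto simp: und_def)
    then show ?thesis using s by blast
  qed
  have eV: "e \<subseteq> verts G" if "e \<in> edges G \<alpha>" for e \<alpha>
    using s that by (auto simp: und_def)
  have g_eq: "g u = g v \<longleftrightarrow> u = v" if "u \<in> verts G" "v \<in> verts G" for u v
    using g that by (auto simp: inj_on_def)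
  have gi_eq: "g ` e = g ` e' \<longleftrightarrow> e = e'" if "e \<subseteq> verts G" "e' \<subseteq> verts G" for e e'
    using inj_on_image_eq_iff[OF g] that by blast
  have "simple_graph (und H)"
    unfolding simple_graph_def und_e
  proof (intro conjI ballI)
    show "finite (fst (und H))" using \<open>finite (verts G)\<close> by (simp add: und_def sel)
    fix e assume "e \<in> (`) g ` snd (und G)"
    then obtain e' where e': "e' \<in> snd (und G)" "e = g ` e'" by blast
    have sub: "e' \<subseteq> verts G" using s e'(1) by blast
    then show "e \<subseteq> fst (und H)" using e'(2) image_mono[OF sub, of g] by (simp add: und_def sel)
    have "inj_on g e'" using g sub by (rule inj_on_subset)
    then show "card e = 2" using s e' by (simp add: card_image)
  qed
  moreover have "\<forall>\<alpha>. arcs H \<alpha> \<noteq> {} \<longrightarrow> \<alpha> \<in> {2 * i | i. 1 \<le> i \<and> i \<le> n}"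
    "\<forall>\<alpha>. edges H \<alpha> \<noteq> {} \<longrightarrow> \<alpha> \<in> {2 * n + 1 .. 2 * n + m}"
    using G unfolding nm_graph_def sel image_is_empty by blast+
  moreover have "\<forall>u v \<alpha> \<beta>. (u, v) \<in> arcs H \<alpha> \<longrightarrow> (u, v) \<in> arcs H \<beta> \<longrightarrow> \<alpha> = \<beta>"
  proof (intro allI impI)
    fix u v \<alpha> \<beta> assume "(u, v) \<in> arcs H \<alpha>" "(u, v) \<in> arcs H \<beta>"
    then obtain a b c d where "(a, b) \<in> arcs G \<alpha>" "(c, d) \<in> arcs G \<beta>" "g a = g c" "g b = g d"
      by (auto simp: sel)
    moreover from this have "a = c" "b = d" using aV g_eq by metis+
    ultimately show "\<alpha> = \<beta>" using G unfolding nm_graph_def by blast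
  qed
  moreover have "\<forall>u v \<alpha> \<beta>. (u, v) \<in> arcs H \<alpha> \<longrightarrow> (v, u) \<notin> arcs H \<beta>"
  proof (intro allI impI notI)
    fix u v \<alpha> \<beta> assume "(u, v) \<in> arcs H \<alpha>" "(v, u) \<in> arcs H \<beta>"
    then obtain a b c d where "(a, b) \<in> arcs G \<alpha>" "(d, c) \<in> arcs G \<beta>" "g a = g c" "g b = g d"
      by (auto simp: sel)
    moreover from this have "a = c" "b = d" using aV g_eq by metis+
    ultimately show False using G unfolding nm_graph_def by blast
  qed
  moreover have "\<forall>u v \<alpha> \<beta>. (u, v) \<in> arcs H \<alpha> \<longrightarrow> {u, v} \<notin> edges H \<beta>"
  proof (intro allI impI notI)
    fix u v \<alpha> \<beta> assume "(u, v) \<in> arcs H \<alpha>" "{u, v} \<in> edges H \<beta>"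
    then obtain a b e where ab: "(a, b) \<in> arcs G \<alpha>" and e: "e \<in> edges G \<beta>" "g ` {a, b} = g ` e"
      by (auto simp: sel)
    then have "{a, b} = e" using gi_eq[of "{a, b}" e] aV[OF ab] eV[OF e(1)] by blast
    then show False using G ab e unfolding nm_graph_def by blast
  qed
  moreover have "\<forall>e \<alpha> \<beta>. e \<in> edges H \<alpha> \<longrightarrow> e \<in> edges H \<beta> \<longrightarrow> \<alpha> = \<beta>"
  proof (intro allI impI)
    fix e \<alpha> \<beta> assume "e \<in> edges H \<alpha>" "e \<in> edges H \<beta>"
    then obtain a b where ab: "a \<in> edges G \<alpha>" "b \<in> edges G \<beta>" "g ` a = g ` b"
      by (auto simp: sel)
    then have "a = b" using gi_eq eV by metis
    then show "\<alpha> = \<beta>" using G ab unfolding nm_graph_def by blast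
  qed
  ultimately have "nm_graph n m H" unfolding nm_graph_def by blast
  moreover have "nm_hom g G H"
    unfolding nm_hom_def
  proof (intro conjI allI impI)
    show "g ` verts G \<subseteq> verts H" by (simp add: sel)
    show "(g u, g v) \<in> arcs H \<alpha>" if "(u, v) \<in> arcs G \<alpha>" for u v \<alpha>
      using imageI[OF that, of "map_prod g g"] by (simp add: sel)
    show "{g u, g v} \<in> edges H \<alpha>" if "{u, v} \<in> edges G \<alpha>" for u v \<alpha>
      using imageI[OF that, of "(`) g"] by (simp add: sel)
  qed
  moreover have "card (verts H) = card (verts G)"
    by (simp add: sel card_image g)
  ultimately show ?thesis by blast
qed

lemma nm_hom_comp: "nm_hom f G H \<Longrightarrow> nm_hom g H K \<Longrightarrow> nm_hom (g \<circ> f) G K"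
  unfolding nm_hom_def image_subset_iff o_apply by blast

lemma nm_chromatic_le:
  fixes G :: "'a mixed_graph" and H :: "'b mixed_graph"
  assumes "nm_graph n m H" "nm_hom f G H"
  shows "nm_chromatic n m G \<le> card (verts H)"
proof -
  obtain K :: "nat mixed_graph" and g
    where "nm_graph n m K" "nm_hom g H K" "card (verts K) = card (verts H)"
    using nm_relabel[OF assms(1)] by blast
  then show ?thesis
    unfolding nm_chromatic_def using nm_hom_comp[OF assms(2)] by (intro Least_le) blast
qed

lemma nm_chromatic_attained:
  fixes G :: "'a mixed_graph"
  assumes "nm_graph n m G"
  shows "\<exists>(H :: nat mixed_graph) f. nm_graph n m H \<and> nm_hom f G H \<and>
           card (verts H) = nm_chromatic n m G"
proof -
  have "\<exists>c (H :: nat mixed_graph) f. nm_graph n m H \<and> nm_hom f G H \<and> card (verts H) = c"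
    using nm_relabel[OF assms] by blast
  from LeastI_ex[OF this] show ?thesis unfolding nm_chromatic_def .
qed

end

(* Subdivide every edge of a complete graph on k vertices once. The two halves of the subdivided
   edges form two star forests, so the arboricity is at most 2. Orient each path u - w - v
   from u to v if there are arcs, or give its two edges different types otherwise. Then
   identifying u with v would put two conflicting adjacencies between the images of w and u,
   so every homomorphism is injective on the k original vertices. *)

theory Submission
  imports Defs "HOL-Library.Nat_Bijection"
begin

text \<open>On a cycle both ends of an edge lie on a further cycle edge, so no edge of a cycle has
  an end private to it. In a star forest the leaf of each edge is such a private end.\<close>

lemma is_forest_if_pendant:
  assumes "\<And>e. e \<in> E \<Longrightarrow> \<exists>x\<in>e. \<forall>e'\<in>E. x \<in> e' \<longrightarrow> e' = e"
  shows "is_forest E"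
  unfolding is_forest_def
proof
  assume "\<exists>p. is_cycle E p"
  then obtain p where l: "3 \<le> length p" and d: "distinct p"
    and i: "\<And>i. i < length p \<Longrightarrow> {p ! i, p ! (Suc i mod length p)} \<in> E"
    by (auto simp: is_cycle_def)
  \<comment> \<open>The three edges around \<open>{a, b}\<close> suffice; \<open>z\<close> is the
    predecessor of \<open>a\<close> around the cycle, and \<open>z = c\<close> when the length is
    3.\<close>
  define a b c z where abcz: "a = p ! 0" "b = p ! 1" "c = p ! 2" "z = p ! (length p - 1)"
  have len: "0 < length p" "Suc 0 < length p" "Suc (Suc 0) < length p"
    "Suc (length p - Suc 0) = length p"
    using l by linarith+
  then have E: "{a, b} \<in> E" "{b, c} \<in> E" "{z, a} \<in> E"
    using i[OF len(1)] i[OF len(2)] i[of "length p - 1"] unfolding abcz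
    by (simp_all add: numeral_2_eq_2)
  have ne: "a \<noteq> c" "b \<noteq> z" "a \<noteq> b"
    unfolding abcz using len l by (simp_all add: nth_eq_iff_index_eq[OF d] numeral_2_eq_2)
  obtain x where "x \<in> {a, b}" "\<And>e'. e' \<in> E \<Longrightarrow> x \<in> e' \<Longrightarrow> e' = {a, b}"
    using assms[OF E(1)] by blast
  then have "{b, c} = {a, b} \<or> {z, a} = {a, b}" using E(2,3) by blast
  then show False using ne by (auto simp: doubleton_eq_iff)
qed

text \<open>An optimal target exists, and it contains an injective image of \<open>S\<close>.
  Targets over \<open>nat\<close> are enough, as \<open>nm_chromatic\<close> ranges over
  these.\<close>

lemma nm_chromatic_ge_inj:
  fixes G :: "'a mixed_graph"
  assumes "nm_graph n m G" and "S \<subseteq> verts G"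
    and inj: "\<And>(H :: nat mixed_graph) f. nm_graph n m H \<Longrightarrow> nm_hom f G H \<Longrightarrow> inj_on f S"
  shows "card S \<le> nm_chromatic n m G"
proof -
  obtain H :: "nat mixed_graph" and f
    where H: "nm_graph n m H" "nm_hom f G H" "card (verts H) = nm_chromatic n m G"
    using nm_chromatic_attained[OF assms(1)] by blast
  have "finite (verts H)" using H(1) by (simp add: nm_graph_def simple_graph_def und_def)
  moreover have "f ` S \<subseteq> verts H" using H(2) assms(2) by (auto simp: nm_hom_def)
  ultimately show ?thesis
    using card_inj_on_le[OF inj[OF H(1,2)]] H(3) by metis
qed

text \<open>The shift by \<open>k\<close> keeps the subdividing vertices apart from the original
  vertices \<open>{..<k}\<close>, and the pairing function keeps them apart from each other.\<close>

definition midpoint :: "nat \<Rightarrow> nat \<Rightarrow> nat \<Rightarrow> nat" where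
  "midpoint k u v = k + prod_encode (u, v)"

text \<open>Using all ordered pairs makes this a finite product image; midpoints with
  \<open>u \<ge> v\<close> are isolated vertices.\<close>

definition subdiv_verts :: "nat \<Rightarrow> nat set" where
  "subdiv_verts k = {..<k} \<union> (\<lambda>(u, v). midpoint k u v) ` ({..<k} \<times> {..<k})"

text \<open>Each edge of the complete graph is listed once, by \<open>u < v\<close>. The halves are
  kept as ordered pairs so that they serve as arcs directly and as edges through
  \<open>undirected\<close>.\<close>

definition tail_halves :: "nat \<Rightarrow> (nat \<times> nat) set" where
  "tail_halves k = {(u, midpoint k u v) | u v. u < v \<and> v < k}"

definition head_halves :: "nat \<Rightarrow> (nat \<times> nat) set" where
  "head_halves k = {(midpoint k u v, v) | u v. u < v \<and> v < k}"

definition undirected :: "('a \<times> 'a) set \<Rightarrow> 'a set set" where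
  "undirected A = {{u, v} | u v. (u, v) \<in> A}"

lemma midpoint_eq_iff [simp]: "midpoint k u v = midpoint k u' v' \<longleftrightarrow> u = u' \<and> v = v'"
  by (simp add: midpoint_def)

lemma midpoint_ge [simp]: "k \<le> midpoint k u v"
  by (simp add: midpoint_def)

lemma midpoint_neq: "u < k \<Longrightarrow> midpoint k a b \<noteq> u"
  using midpoint_ge[of k a b] by linarith

lemma undirected_tail_halves:
  "undirected (tail_halves k) = {{u, midpoint k u v} | u v. u < v \<and> v < k}"
  by (auto simp: undirected_def tail_halves_def)

lemma undirected_head_halves:
  "undirected (head_halves k) = {{midpoint k u v, v} | u v. u < v \<and> v < k}"
  by (auto simp: undirected_def head_halves_def)

text \<open>The only element of a half that is at least \<open>k\<close> is its midpoint, which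
  determines \<open>u\<close> and \<open>v\<close>; the other ends then differ because
  \<open>u < v\<close>.\<close>

lemma halves_disjoint: "undirected (tail_halves k) \<inter> undirected (head_halves k) = {}"
  unfolding undirected_tail_halves undirected_head_halves
  by (auto simp: doubleton_eq_iff dest: midpoint_neq)

text \<open>These are stars centred at the smaller ends \<open>u\<close>; the midpoint is the
  private end of each edge.\<close>

lemma is_forest_tail_halves: "is_forest (undirected (tail_halves k))"
proof (rule is_forest_if_pendant)
  fix e assume "e \<in> undirected (tail_halves k)"
  then obtain u v where e: "e = {u, midpoint k u v}" "u < v" "v < k"
    unfolding undirected_tail_halves by blast
  have "\<forall>e'\<in>undirected (tail_halves k). midpoint k u v \<in> e' \<longrightarrow> e' = e"
    unfolding undirected_tail_halves e(1) by (auto dest: midpoint_neq less_trans)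
  then show "\<exists>x\<in>e. \<forall>e'\<in>undirected (tail_halves k). x \<in> e' \<longrightarrow> e' = e"
    using e(1) by blast
qed

lemma is_forest_head_halves: "is_forest (undirected (head_halves k))"
proof (rule is_forest_if_pendant)
  fix e assume "e \<in> undirected (head_halves k)"
  then obtain u v where e: "e = {midpoint k u v, v}" "u < v" "v < k"
    unfolding undirected_head_halves by blast
  have "\<forall>e'\<in>undirected (head_halves k). midpoint k u v \<in> e' \<longrightarrow> e' = e"
    unfolding undirected_head_halves e(1) by (auto dest: midpoint_neq less_trans)
  then show "\<exists>x\<in>e. \<forall>e'\<in>undirected (head_halves k). x \<in> e' \<longrightarrow> e' = e"
    using e(1) by blast
qed

abbreviation subdivision :: "nat \<Rightarrow> nat ugraph" where
  "subdivision k \<equiv> (subdiv_verts k, undirected (tail_halves k) \<union> undirected (head_halves k))"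

lemma simple_graph_subdivision: "simple_graph (subdivision k)"
proof -
  have "e \<subseteq> subdiv_verts k \<and> card e = 2"
    if "e \<in> undirected (tail_halves k) \<union> undirected (head_halves k)" for e
  proof -
    have "\<exists>u v. (e = {u, midpoint k u v} \<or> e = {midpoint k u v, v}) \<and> u < v \<and> v < k"
      using that by (auto simp: undirected_tail_halves undirected_head_halves)
    then obtain u v where "e = {u, midpoint k u v} \<or> e = {midpoint k u v, v}" "u < v" "v < k"
      by blast
    moreover from this have "midpoint k u v \<noteq> u" "midpoint k u v \<noteq> v"
      using midpoint_neq by auto
    ultimately show ?thesis by (auto simp: subdiv_verts_def)
  qed
  then show ?thesis by (simp add: simple_graph_def) (simp add: subdiv_verts_def)
qed

lemma arboricity_subdivision: "arboricity (subdivision k) \<le> 2"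
proof -
  have "forest_decomposition (snd (subdivision k)) 2
     (\<lambda>i. if i = 0 then undirected (tail_halves k) else undirected (head_halves k))"
    using halves_disjoint[of k] is_forest_tail_halves[of k] is_forest_head_halves[of k]
    by (auto simp: forest_decomposition_def disjoint_family_on_def less_2_cases_iff)
  then show ?thesis unfolding arboricity_def by (intro Least_le) blast
qed

text \<open>Type 2 is the first arc type and exists as soon as \<open>n \<ge> 1\<close>; the
  conflict will come from direction, so one type serves both halves.\<close>

definition directed_subdivision :: "nat \<Rightarrow> nat mixed_graph" where
  "directed_subdivision k = \<lparr>verts = subdiv_verts k,
     arcs = (\<lambda>\<alpha>. if \<alpha> = 2 then tail_halves k \<union> head_halves k else {}),
     edges = (\<lambda>\<alpha>. {})\<rparr>"

text \<open>The types are the first two edge types, both present once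
  \<open>m \<ge> 2\<close>.\<close>

definition bicolored_subdivision :: "nat \<Rightarrow> nat \<Rightarrow> nat mixed_graph" where
  "bicolored_subdivision n k = \<lparr>verts = subdiv_verts k,
     arcs = (\<lambda>\<alpha>. {}),
     edges = (\<lambda>\<alpha>. if \<alpha> = 2 * n + 1 then undirected (tail_halves k)
       else if \<alpha> = 2 * n + 2 then undirected (head_halves k) else {})\<rparr>"

lemma und_directed_subdivision: "und (directed_subdivision k) = subdivision k"
  by (auto simp: und_def directed_subdivision_def undirected_def split: if_splits)

lemma und_bicolored_subdivision: "und (bicolored_subdivision n k) = subdivision k"
proof -
  have "edges (bicolored_subdivision n k) (2 * n + 1) = undirected (tail_halves k)"
    "edges (bicolored_subdivision n k) (2 * n + 2) = undirected (head_halves k)"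
    by (simp_all add: bicolored_subdivision_def)
  then have "snd (subdivision k) \<subseteq> {e. \<exists>\<alpha>. e \<in> edges (bicolored_subdivision n k) \<alpha>}"
    unfolding snd_conv by blast
  then show ?thesis
    by (auto simp: und_def bicolored_subdivision_def split: if_splits)
qed

lemma nm_graph_directed_subdivision:
  assumes "1 \<le> n"
  shows "nm_graph n m (directed_subdivision k)"
proof -
  let ?G = "directed_subdivision k"
  have arcs: "arcs ?G \<alpha> = (if \<alpha> = 2 then tail_halves k \<union> head_halves k else {})"
    and edges: "edges ?G \<alpha> = {}" for \<alpha>
    by (simp_all add: directed_subdivision_def)
  have only2: "\<alpha> = 2" if "a \<in> arcs ?G \<alpha>" for a \<alpha>
    using that unfolding arcs by (metis empty_iff)
  show ?thesis
    unfolding nm_graph_def und_directed_subdivision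
  proof (intro conjI allI impI)
    show "simple_graph (subdivision k)" by (rule simple_graph_subdivision)
  next
    fix \<alpha> assume "arcs ?G \<alpha> \<noteq> {}"
    then have "\<alpha> = 2" using only2 by blast
    then show "\<alpha> \<in> {2 * i | i. 1 \<le> i \<and> i \<le> n}"
      using assms by (intro CollectI exI[of _ 1]) simp
  next
    fix u v \<alpha> \<beta> assume "(u, v) \<in> arcs ?G \<alpha>" "(u, v) \<in> arcs ?G \<beta>"
    then show "\<alpha> = \<beta>" using only2 by metis
  next
    fix u v \<alpha> \<beta> assume uv: "(u, v) \<in> arcs ?G \<alpha>"
    \<comment> \<open>A reversed tail half starts at a midpoint, so it could only be a head half;
      this would make the two ends of the subdivided edge equal. Reversed head halves are
      symmetric.\<close>
    have "(v, u) \<notin> tail_halves k \<union> head_halves k" if "(u, v) \<in> tail_halves k \<union> head_halves k"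
      using that by (auto simp: tail_halves_def head_halves_def dest: midpoint_neq less_trans)
    then show "(v, u) \<notin> arcs ?G \<beta>" using uv unfolding arcs by (metis empty_iff)
  qed (simp_all add: edges)
qed

lemma nm_graph_bicolored_subdivision:
  assumes "2 \<le> m"
  shows "nm_graph n m (bicolored_subdivision n k)"
proof -
  have arcs: "arcs (bicolored_subdivision n k) \<alpha> = {}"
    and edges: "edges (bicolored_subdivision n k) \<alpha> =
      (if \<alpha> = 2 * n + 1 then undirected (tail_halves k)
       else if \<alpha> = 2 * n + 2 then undirected (head_halves k) else {})" for \<alpha>
    by (simp_all add: bicolored_subdivision_def)
  have "\<alpha> = \<beta>" if "e \<in> edges (bicolored_subdivision n k) \<alpha>" "e \<in> edges (bicolored_subdivision n k) \<beta>"
    for e \<alpha> \<beta>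
    using that halves_disjoint[of k] unfolding edges by (auto split: if_splits)
  moreover have "\<alpha> \<in> {2 * n + 1..2 * n + m}" if "edges (bicolored_subdivision n k) \<alpha> \<noteq> {}" for \<alpha>
    using that assms unfolding edges by (simp split: if_splits)
  ultimately show ?thesis
    using simple_graph_subdivision[of k]
    unfolding nm_graph_def und_bicolored_subdivision arcs by blast
qed

lemma inj_on_if_separates:
  fixes f :: "'a::linorder \<Rightarrow> 'b"
  assumes "\<And>u v. u < v \<Longrightarrow> v < k \<Longrightarrow> f u \<noteq> f v"
  shows "inj_on f {..<k}"
  using assms by (intro inj_onI) (metis lessThan_iff neq_iff)

lemma nm_chromatic_directed_subdivision:
  assumes "1 \<le> n"
  shows "k \<le> nm_chromatic n m (directed_subdivision k)"
proof -
  have sub: "{..<k} \<subseteq> verts (directed_subdivision k)"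
    by (simp add: directed_subdivision_def subdiv_verts_def)
  have "inj_on f {..<k}"
    if H: "nm_graph n m H" and f: "nm_hom f (directed_subdivision k) H"
    for H :: "nat mixed_graph" and f
  proof (rule inj_on_if_separates)
    fix u v assume "u < v" "v < k"
    then have "(u, midpoint k u v) \<in> arcs (directed_subdivision k) 2"
      "(midpoint k u v, v) \<in> arcs (directed_subdivision k) 2"
      by (auto simp: directed_subdivision_def tail_halves_def head_halves_def)
    then have "(f u, f (midpoint k u v)) \<in> arcs H 2" "(f (midpoint k u v), f v) \<in> arcs H 2"
      using f by (auto simp: nm_hom_def)
    \<comment> \<open>If \<open>f u = f v\<close>, these would be two opposite arcs of
      \<open>H\<close>.\<close>
    then show "f u \<noteq> f v" using H unfolding nm_graph_def by metis
  qed
  then show ?thesis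
    using nm_chromatic_ge_inj[OF nm_graph_directed_subdivision[OF assms] sub] by simp
qed

lemma nm_chromatic_bicolored_subdivision:
  assumes "2 \<le> m"
  shows "k \<le> nm_chromatic n m (bicolored_subdivision n k)"
proof -
  have sub: "{..<k} \<subseteq> verts (bicolored_subdivision n k)"
    by (simp add: bicolored_subdivision_def subdiv_verts_def)
  have "inj_on f {..<k}"
    if H: "nm_graph n m H" and f: "nm_hom f (bicolored_subdivision n k) H"
    for H :: "nat mixed_graph" and f
  proof (rule inj_on_if_separates)
    fix u v assume "u < v" "v < k"
    then have "{u, midpoint k u v} \<in> edges (bicolored_subdivision n k) (2 * n + 1)"
      "{midpoint k u v, v} \<in> edges (bicolored_subdivision n k) (2 * n + 2)"
      by (auto simp: bicolored_subdivision_def undirected_tail_halves undirected_head_halves)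
    then have "{f u, f (midpoint k u v)} \<in> edges H (2 * n + 1)"
      "{f (midpoint k u v), f v} \<in> edges H (2 * n + 2)"
      using f unfolding nm_hom_def by blast+
    \<comment> \<open>An edge of \<open>H\<close> has one type only. If \<open>f u = f v\<close>,
      the two image edges would be the same set carrying both types.\<close>
    moreover have "e \<notin> edges H (2 * n + 1) \<or> e \<notin> edges H (2 * n + 2)" for e
      using H unfolding nm_graph_def by (metis add_left_imp_eq one_eq_numeral_iff semiring_norm(83))
    ultimately show "f u \<noteq> f v" by (metis insert_commute)
  qed
  then show ?thesis
    using nm_chromatic_ge_inj[OF nm_graph_bicolored_subdivision[OF assms] sub] by simp
qed

theorem theorem2p1:
  fixes n m k r :: nat
  assumes "2 * n + m \<ge> 1" and "(n, m) \<noteq> (0, 1)"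
    and "k \<ge> 2" and "r \<ge> 2"
  shows "\<exists>G :: nat mixed_graph.
           nm_graph n m G \<and> arboricity (und G) \<le> r \<and> nm_chromatic n m G \<ge> k"
proof -
  have arb: "arboricity (subdivision k) \<le> r"
    using arboricity_subdivision[of k] assms(4) by linarith
  \<comment> \<open>If \<open>n = 0\<close>, the first assumption gives \<open>m \<ge> 1\<close> and
    the second excludes \<open>m = 1\<close>.\<close>
  consider "1 \<le> n" | "2 \<le> m" using assms(1,2) by fastforce
  then show ?thesis
  proof cases
    case 1
    then show ?thesis
      using nm_graph_directed_subdivision nm_chromatic_directed_subdivision arb
        und_directed_subdivision by metis
  next
    case 2
    then show ?thesis
      using nm_graph_bicolored_subdivision nm_chromatic_bicolored_subdivision arb
        und_bicolored_subdivision by metis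
  qed
qed

end
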